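(* For any graph $G$ and any positive integer $t$, $\chi(S(G,t))=\chi(G)$, where $\chi$ denotes the chromatic number.
   Context: For a graph $G=(V,E)$ and a positive integer $t$, $V^t$ denotes the set of words $u=u_1u_2\cdots u_t$ of length $t$ over the alphabet $V$. The generalized Sierpiński graph $S(G,t)$ has vertex set $V^t$, and $\{u,v\}$ is an edge if and only if there is $i\in\{1,\dots,t\}$ such that: (i) $u_j=v_j$ for all $j<i$; (ii) $u_i\ne v_i$ and $\{u_i,v_i\}\in E$; (iii) $u_j=v_i$ and $v_j=u_i$ for all $j>i$. Graphs are finite, simple and non-empty. *)

theory Defs
  imports "Graph_Theory.Pair_Digraph"
begin

text \<open>
  A finite simple graph is a \<^locale>\<open>pair_graph\<close>: a finite vertex set with a symmetric,
  irreflexive set of ordered pairs of vertices. The undirected edge \<open>{u, v}\<close> is represented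
  by the two arcs \<open>(u, v)\<close> and \<open>(v, u)\<close>. The locale admits the graph without vertices.
\<close>

definition words :: "'a set \<Rightarrow> nat \<Rightarrow> 'a list set" where
  "words V t = {u. length u = t \<and> set u \<subseteq> V}"

text \<open>Positions in a word are numbered from \<open>0\<close> to \<open>t - 1\<close>.\<close>

definition sierpinski_arc :: "'a pair_pre_digraph \<Rightarrow> nat \<Rightarrow> 'a list \<Rightarrow> 'a list \<Rightarrow> bool" where
  "sierpinski_arc G t u v \<longleftrightarrow>
     (\<exists>i<t. (\<forall>j<i. u ! j = v ! j) \<and>
            (u ! i \<noteq> v ! i \<and> (u ! i, v ! i) \<in> parcs G) \<and>
            (\<forall>j. i < j \<and> j < t \<longrightarrow> u ! j = v ! i \<and> v ! j = u ! i))"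

definition sierpinski :: "'a pair_pre_digraph \<Rightarrow> nat \<Rightarrow> 'a list pair_pre_digraph" where
  "sierpinski G t =
     \<lparr> pverts = words (pverts G) t,
       parcs = {(u, v). u \<in> words (pverts G) t \<and> v \<in> words (pverts G) t \<and> sierpinski_arc G t u v} \<rparr>"

definition proper_colouring :: "'a pair_pre_digraph \<Rightarrow> nat \<Rightarrow> ('a \<Rightarrow> nat) \<Rightarrow> bool" where
  "proper_colouring G k c \<longleftrightarrow>
     (\<forall>v\<in>pverts G. c v < k) \<and> (\<forall>(u, v)\<in>parcs G. c u \<noteq> c v)"

definition chromatic_number :: "'a pair_pre_digraph \<Rightarrow> nat" where
  "chromatic_number G = (LEAST k. \<exists>c. proper_colouring G k c)"

text \<open>The minimum in \<^const>\<open>chromatic_number\<close> is attained for every finite simple graph.\<close>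

lemma (in pair_graph) ex_proper_colouring:
  "\<exists>k c. proper_colouring G k c"
proof -
  obtain c :: "'a \<Rightarrow> nat" and n where c: "c ` pverts G = {i. i < n}" "inj_on c (pverts G)"
    using finite_imp_inj_to_nat_seg[OF pair_finite_verts] by blast
  have "c v < n" if "v \<in> pverts G" for v
    using c(1) that by blast
  moreover have "c u \<noteq> c v" if e: "(u, v) \<in> parcs G" for u v
  proof -
    have "u \<noteq> v" using pair_no_loops[OF e] by simp
    then show ?thesis using inj_onD[OF c(2)] in_arcsD1[OF e] in_arcsD2[OF e] by blast
  qed
  ultimately have "proper_colouring G n c"
    unfolding proper_colouring_def by blast
  then show ?thesis by blast
qed

lemma (in pair_graph) pair_graph_sierpinski:
  "pair_graph (sierpinski G t)"
proof -
  have fin: "finite (words (pverts G) t)"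
    using finite_lists_length_eq[OF pair_finite_verts, of t]
    unfolding words_def by (simp only: conj_commute)
  have E: "parcs (sierpinski G t) \<subseteq> words (pverts G) t \<times> words (pverts G) t"
    unfolding sierpinski_def by auto
  have flip: "(b, a) \<in> parcs G" if "(a, b) \<in> parcs G" for a b
    using arcs_ends_symmetric[OF pair_sym_arcs, of a b] that by simp
  have sym: "sierpinski_arc G t v u" if "sierpinski_arc G t u v" for u v
  proof -
    obtain i where i: "i < t" "\<forall>j<i. u ! j = v ! j" "u ! i \<noteq> v ! i" "(u ! i, v ! i) \<in> parcs G"
      "\<forall>j. i < j \<and> j < t \<longrightarrow> u ! j = v ! i \<and> v ! j = u ! i"
      using \<open>sierpinski_arc G t u v\<close> unfolding sierpinski_arc_def by blast
    show ?thesis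
      unfolding sierpinski_arc_def
    proof (intro exI[of _ i] conjI allI impI)
      show "(v ! i, u ! i) \<in> parcs G" using flip i(4) .
    qed (use i in auto)
  qed
  show ?thesis
  proof
    show "finite (pverts (sierpinski G t))" using fin by (simp add: sierpinski_def)
    show "finite (parcs (sierpinski G t))"
      using finite_subset[OF E finite_cartesian_product[OF fin fin]] .
    show "symmetric (with_proj (sierpinski G t))"
      unfolding symmetric_def with_proj_simps
      by (rule symI) (auto simp: sierpinski_def intro: sym)
  next
    fix e assume e: "e \<in> parcs (sierpinski G t)"
    show "fst e \<in> pverts (sierpinski G t)" "snd e \<in> pverts (sierpinski G t)"
      using e by (auto simp: sierpinski_def)
    show "fst e \<noteq> snd e"
    proof -
      have "sierpinski_arc G t (fst e) (snd e)"
        using e by (auto simp: sierpinski_def)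
      then show ?thesis unfolding sierpinski_arc_def by metis
    qed
  qed
qed

end

theory Submission
  imports Defs
begin

text \<open>
  Colour a word by the colour of its last letter: if \<open>u\<close> and \<open>v\<close> are adjacent and differ first
  in position \<open>i\<close>, their last letters are \<open>u\<^sub>i\<close> and \<open>v\<^sub>i\<close> in some order, hence adjacent
  in \<open>G\<close>. Conversely, the words that extend a fixed prefix of length \<open>t - 1\<close> span a copy of \<open>G\<close>.
  So there are graph homomorphisms in both directions, along which colourings pull back.
\<close>

lemma proper_colouring_comp:
  assumes "proper_colouring H k c"
    and "\<And>v. v \<in> pverts G \<Longrightarrow> f v \<in> pverts H"
    and "\<And>u v. (u, v) \<in> parcs G \<Longrightarrow> (f u, f v) \<in> parcs H"
  shows "proper_colouring G k (c \<circ> f)"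
  using assms unfolding proper_colouring_def by fastforce

text \<open>Pulling back along \<open>f\<close> and \<open>g\<close> shows that the same
  \<open>k\<close> admit a proper colouring of \<open>G\<close> and of \<open>H\<close>, so both
  \<open>LEAST\<close> terms range over one predicate.\<close>

lemma chromatic_number_eqI:
  assumes "\<And>v. v \<in> pverts G \<Longrightarrow> f v \<in> pverts H"
    and "\<And>u v. (u, v) \<in> parcs G \<Longrightarrow> (f u, f v) \<in> parcs H"
    and "\<And>v. v \<in> pverts H \<Longrightarrow> g v \<in> pverts G"
    and "\<And>u v. (u, v) \<in> parcs H \<Longrightarrow> (g u, g v) \<in> parcs G"
  shows "chromatic_number H = chromatic_number G"
proof -
  have "(\<exists>c. proper_colouring H k c) \<longleftrightarrow> (\<exists>c. proper_colouring G k c)" for k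
    using proper_colouring_comp[of H k _ G f] proper_colouring_comp[of G k _ H g] assms by blast
  then show ?thesis
    unfolding chromatic_number_def by simp
qed

lemma (in pair_graph) sierpinski_arc_last:
  assumes "sierpinski_arc G t u v" "length u = t" "length v = t"
  shows "(last u, last v) \<in> parcs G"
proof -
  obtain i where i: "i < t" "(u ! i, v ! i) \<in> parcs G"
      "\<forall>j. i < j \<and> j < t \<longrightarrow> u ! j = v ! i \<and> v ! j = u ! i"
    using assms(1) unfolding sierpinski_arc_def by blast
  have last: "last u = u ! (t - 1)" "last v = v ! (t - 1)"
    using i(1) assms(2,3) by (metis last_conv_nth list.size(3) not_less_zero)+
  show ?thesis
  proof (cases "i = t - 1")
    case True
    then show ?thesis using i(2) last by simp
  next
    case False
    \<comment> \<open>The last position lies beyond \<open>i\<close>, where the two letters are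
      swapped; symmetry of the arcs undoes the swap.\<close>
    then have "last u = v ! i" "last v = u ! i"
      using i(1,3) last by simp_all
    then show ?thesis
      using i(2) arcs_ends_symmetric[OF pair_sym_arcs, of "u ! i" "v ! i"] by simp
  qed
qed

lemma (in pair_graph) sierpinski_arc_snoc:
  assumes "(u, v) \<in> parcs G"
  shows "sierpinski_arc G (Suc (length w)) (w @ [u]) (w @ [v])"
  unfolding sierpinski_arc_def
  using assms pair_no_loops[OF assms]
  \<comment> \<open>The words first differ in their last position, so the condition on later
    positions is vacuous.\<close>
  by (intro exI[of _ "length w"]) (auto simp: nth_append)

theorem theorem5:
  fixes G :: "'a pair_pre_digraph" and t :: nat
  assumes "pair_graph G"
    and "pverts G \<noteq> {}"
    and "t \<ge> 1"
  shows "chromatic_number (sierpinski G t) = chromatic_number G"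
proof -
  interpret pair_graph G by fact
  obtain r where r: "r \<in> pverts G" using assms(2) by blast
  \<comment> \<open>Any word of length \<open>t - 1\<close> over the vertices would serve as the
    common prefix; it is empty if \<open>t = 1\<close>.\<close>
  define w where "w = replicate (t - 1) r"
  have w: "Suc (length w) = t" "set w \<subseteq> pverts G"
    using assms(3) r unfolding w_def by auto
  show ?thesis
  proof (rule chromatic_number_eqI[where f = "\<lambda>v. w @ [v]" and g = last])
    show vert: "w @ [v] \<in> pverts (sierpinski G t)" if "v \<in> pverts G" for v
      using that w by (simp add: sierpinski_def words_def)
    show "(w @ [u], w @ [v]) \<in> parcs (sierpinski G t)" if e: "(u, v) \<in> parcs G" for u v
      using sierpinski_arc_snoc[OF e, of w] vert[OF in_arcsD1[OF e]] vert[OF in_arcsD2[OF e]] w(1)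
      by (simp add: sierpinski_def)
    show "last u \<in> pverts G" if "u \<in> pverts (sierpinski G t)" for u
    proof -
      have "u \<noteq> []" "set u \<subseteq> pverts G"
        using that assms(3) by (auto simp: sierpinski_def words_def)
      then show ?thesis using last_in_set by blast
    qed
    show "(last u, last v) \<in> parcs G" if "(u, v) \<in> parcs (sierpinski G t)" for u v
      using that sierpinski_arc_last[of t u v] by (simp add: sierpinski_def words_def)
  qed
qed

end
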